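(* A real Banach space $X$ has the Uniform Mazur Intersection Property if and only if $\beta(t) > 0$ for every $0<t<1$.
   Context: $B(\cdot)$, $S(\cdot)$ denote closed unit ball and unit sphere. $X$ has the Uniform Mazur Intersection Property (UMIP) if for every $\varepsilon>0$ there is $K>0$ such that for every closed bounded convex $C \subseteq X$ and $p \in X$ with $\operatorname{diam}(C) < 1/\varepsilon$ and $d(p,C) \geq \varepsilon$, there is a closed ball $B[x_0,r_0] \supseteq C$ with $d(p, B[x_0,r_0]) \geq \varepsilon/2$ and $r_0 \leq K$. For $f \in S(X^* )$, $x \in S(X)$, $0<t<1$: $\beta(f,x,t) := \inf\{1 - g(x) : g \in B(X^* ),\ \|f-g\| \geq t\}$, $\beta(f,t) := \sup_{x \in S(X)} \beta(f,x,t)$, and $\beta(t) := \inf_{f \in S(X^* )} \beta(f,t)$. *)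

theory Defs
  imports "HOL-Analysis.Analysis"
begin

definition UMIP :: "'a::real_normed_vector itself \<Rightarrow> bool" where
  "UMIP (TYPE('a)) \<longleftrightarrow>
     (\<forall>\<epsilon>>0. \<exists>K>0. \<forall>(C::'a set) (p::'a).
        closed C \<and> convex C \<and> bounded C \<and> diameter C < 1/\<epsilon> \<and> infdist p C \<ge> \<epsilon> \<longrightarrow>
        (\<exists>x0 r0. C \<subseteq> cball x0 r0 \<and> infdist p (cball x0 r0) \<ge> \<epsilon>/2 \<and> r0 \<le> K))"

definition beta_fxt :: "('a::real_normed_vector \<Rightarrow>\<^sub>L real) \<Rightarrow> 'a \<Rightarrow> real \<Rightarrow> real" where
  "beta_fxt f x t = Inf {1 - blinfun_apply g x | g. norm g \<le> 1 \<and> norm (f - g) \<ge> t}"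

definition beta_ft :: "('a::real_normed_vector \<Rightarrow>\<^sub>L real) \<Rightarrow> real \<Rightarrow> real" where
  "beta_ft f t = Sup ((\<lambda>x. beta_fxt f x t) ` {x::'a. norm x = 1})"

definition beta_t :: "'a::real_normed_vector itself \<Rightarrow> real \<Rightarrow> real" where
  "beta_t (TYPE('a)) t = Inf ((\<lambda>f. beta_ft f t) ` {f::'a \<Rightarrow>\<^sub>L real. norm f = 1})"

end

theory Submission
  imports Defs
begin

text \<open>
  Positivity of \<open>\<beta>(t)\<close> means that every norm-one functional \<open>f\<close> admits a unit vector \<open>x\<close> such that
  the slice \<open>{g \<in> B(X*). g(x) > 1 - d}\<close> lies within distance \<open>t\<close> of \<open>f\<close>, with \<open>d\<close> independent
  of \<open>f\<close>.

  Given such slices, separate \<open>C\<close> from \<open>p\<close> by \<open>f\<close> and use the ball of centre \<open>p + l x\<close> and radius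
  \<open>l - \<epsilon>/2\<close>. A functional \<open>g\<close> norming \<open>p + l x - c\<close> is either close to \<open>f\<close>, hence at least
  \<open>\<epsilon>/2\<close> at \<open>c - p\<close>, or satisfies \<open>g(x) \<le> 1 - d\<close>, which gains \<open>l d\<close>; so a large \<open>l\<close>
  works. If \<open>C\<close> is far from \<open>p\<close>, a ball centred in \<open>C\<close> does.

  Conversely, apply the intersection property to \<open>p = 0\<close> and the part of the unit ball where
  \<open>f \<ge> \<epsilon>\<close>, and let \<open>x\<close> be the normalised centre of the resulting ball. A functional in a thin
  slice at \<open>x\<close> is nonnegative on that part of the unit ball, hence nearly vanishes on the kernel of
  \<open>f\<close>, hence is close to \<open>f\<close>.

  The Hahn-Banach theorem is obtained from Zorn's lemma applied to sublinear functionals, whose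
  minimal elements are linear.
\<close>

section \<open>Sublinear functionals and their tilts\<close>

text \<open>Homogeneity is asked as an inequality only, which is what infima of sublinear
  functionals satisfy directly; equality follows by scaling back with
  \<open>inverse a\<close>.\<close>

definition sublinear :: "('a::real_vector \<Rightarrow> real) \<Rightarrow> bool" where
  "sublinear q \<longleftrightarrow> (\<forall>x y. q (x + y) \<le> q x + q y) \<and> (\<forall>a\<ge>0. \<forall>x. q (a *\<^sub>R x) \<le> a * q x)"

lemma sublinearI:
  assumes "\<And>x y. q (x + y) \<le> q x + q y" "\<And>a x. 0 \<le> a \<Longrightarrow> q (a *\<^sub>R x) \<le> a * q x"
  shows "sublinear q"
  using assms by (simp add: sublinear_def)

lemma sublinear_add: "sublinear q \<Longrightarrow> q (x + y) \<le> q x + q y"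
  by (simp add: sublinear_def)

lemma sublinear_zero:
  assumes "sublinear q"
  shows "q 0 = 0"
proof -
  have "q (0 *\<^sub>R 0) \<le> 0 * q 0" "q (0 + 0) \<le> q 0 + q 0"
    using assms unfolding sublinear_def by blast+
  then show ?thesis by simp
qed

lemma sublinear_scale:
  assumes "sublinear q" "0 \<le> a"
  shows "q (a *\<^sub>R x) = a * q x"
proof (cases "a = 0")
  case False
  then have "a > 0" using assms by simp
  then have "q (inverse a *\<^sub>R (a *\<^sub>R x)) \<le> inverse a * q (a *\<^sub>R x)" "q (a *\<^sub>R x) \<le> a * q x"
    using assms unfolding sublinear_def by (simp_all del: scaleR_scaleR)
  then show ?thesis using \<open>a > 0\<close> by (simp add: field_simps)
qed (simp add: sublinear_zero assms)

lemma sublinear_ge_uminus: "sublinear q \<Longrightarrow> - q (- x) \<le> q x"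
  using sublinear_add[of q x "- x"] sublinear_zero[of q] by simp

lemma sublinear_norm: "sublinear norm"
  by (rule sublinearI) (auto intro: norm_triangle_ineq)

text \<open>The largest sublinear functional below \<open>q\<close> that is at most \<open>- e\<close> on \<open>- C\<close>.\<close>

definition tilt :: "('a::real_vector \<Rightarrow> real) \<Rightarrow> 'a set \<Rightarrow> real \<Rightarrow> 'a \<Rightarrow> real" where
  "tilt q C e x = (INF (s, c) \<in> {0..} \<times> C. q (x + s *\<^sub>R c) - s * e)"

text \<open>The hypothesis \<open>e <= q c\<close> bounds the infimum below by
  \<open>- q (- x)\<close>, so \<open>INF\<close> is a genuine infimum. Convexity of
  \<open>C\<close> gives subadditivity, because the cone over \<open>C\<close> is closed under
  addition. The upper bounds come from \<open>s = 0\<close> and from \<open>s = 1\<close>.\<close>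

lemma
  fixes C :: "'a::real_vector set"
  assumes q: "sublinear q" and C: "convex C" "C \<noteq> {}" and e: "\<And>c. c \<in> C \<Longrightarrow> e \<le> q c"
  shows tilt_lower: "\<And>s c x. 0 \<le> s \<Longrightarrow> c \<in> C \<Longrightarrow> tilt q C e x \<le> q (x + s *\<^sub>R c) - s * e"
    and sublinear_tilt: "sublinear (tilt q C e)"
    and tilt_le: "\<And>x. tilt q C e x \<le> q x"
    and tilt_uminus_le: "\<And>c. c \<in> C \<Longrightarrow> tilt q C e (- c) \<le> - e"
proof -
  have lb: "- q (- x) \<le> q (x + s *\<^sub>R c) - s * e" if "0 \<le> s" "c \<in> C" for s c x
  proof -
    have "s * e \<le> s * q c" using that e by (simp add: mult_left_mono)
    also have "\<dots> = q ((x + s *\<^sub>R c) + - x)" using that q by (simp add: sublinear_scale)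
    also have "\<dots> \<le> q (x + s *\<^sub>R c) + q (- x)" by (rule sublinear_add[OF q])
    finally show ?thesis by simp
  qed
  show lower: "tilt q C e x \<le> q (x + s *\<^sub>R c) - s * e" if "0 \<le> s" "c \<in> C" for s c x
  proof -
    have "bdd_below ((\<lambda>(s, c). q (x + s *\<^sub>R c) - s * e) ` ({0..} \<times> C))"
      by (rule bdd_belowI2[of _ "- q (- x)"]) (use lb in auto)
    from cINF_lower[OF this, of "(s, c)"] that show ?thesis unfolding tilt_def by simp
  qed
  have greatest: "l \<le> tilt q C e x"
    if "\<And>s c. 0 \<le> s \<Longrightarrow> c \<in> C \<Longrightarrow> l \<le> q (x + s *\<^sub>R c) - s * e" for l x
    unfolding tilt_def by (rule cINF_greatest) (use C that in auto)
  show "tilt q C e x \<le> q x" for x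
    using C lower[of 0] by auto
  show "tilt q C e (- c) \<le> - e" if "c \<in> C" for c
    using lower[of 1 c "- c"] that q by (simp add: sublinear_zero)
  show "sublinear (tilt q C e)"
  proof (rule sublinearI)
    fix x y
    have two: "tilt q C e (x + y) \<le> (q (x + s *\<^sub>R c) - s * e) + (q (y + t *\<^sub>R d) - t * e)"
      if h: "0 \<le> s" "c \<in> C" "0 \<le> t" "d \<in> C" for s c t d
    proof -
      \<comment> \<open>The normalised combination of \<open>c\<close> and \<open>d\<close> stays in
        \<open>C\<close>; if both weights vanish, any point of \<open>C\<close> serves.\<close>
      obtain z where z: "z \<in> C" "(s + t) *\<^sub>R z = s *\<^sub>R c + t *\<^sub>R d"
      proof (cases "s + t = 0")
        case True
        then have "s = 0" "t = 0" using h by auto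
        then show ?thesis using that[of c] h by simp
      next
        case False
        then have "s + t > 0" using h by simp
        then have "(s / (s + t)) *\<^sub>R c + (t / (s + t)) *\<^sub>R d \<in> C"
          using h by (intro convexD[OF C(1)]) (auto simp: add_divide_distrib[symmetric])
        then show ?thesis by (rule that) (use False in \<open>simp add: scaleR_right_distrib\<close>)
      qed
      have "tilt q C e (x + y) \<le> q ((x + y) + (s + t) *\<^sub>R z) - (s + t) * e"
        using h z by (intro lower) auto
      also have "(x + y) + (s + t) *\<^sub>R z = (x + s *\<^sub>R c) + (y + t *\<^sub>R d)"
        by (simp add: z)
      also have "q \<dots> - (s + t) * e \<le> q (x + s *\<^sub>R c) + q (y + t *\<^sub>R d) - (s + t) * e"
        using sublinear_add[OF q] by simp
      finally show ?thesis by (simp add: algebra_simps)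
    qed
    \<comment> \<open>The infima are taken one after the other: first over the pair belonging to
      \<open>y\<close>, then over the one belonging to \<open>x\<close>.\<close>
    have "tilt q C e (x + y) - (q (x + s *\<^sub>R c) - s * e) \<le> tilt q C e y"
      if "0 \<le> s" "c \<in> C" for s c
      by (rule greatest) (use two that in \<open>fastforce simp: algebra_simps\<close>)
    then have "tilt q C e (x + y) - tilt q C e y \<le> tilt q C e x"
      by (intro greatest) (fastforce simp: algebra_simps)
    then show "tilt q C e (x + y) \<le> tilt q C e x + tilt q C e y" by simp
  next
    fix a :: real and x assume a: "0 \<le> a"
    show "tilt q C e (a *\<^sub>R x) \<le> a * tilt q C e x"
    proof (cases "a = 0")
      case True
      obtain c where "c \<in> C" using C by auto
      then show ?thesis using True lower[of 0 c 0] q by (simp add: sublinear_zero)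
    next
      case False
      with a have a: "a > 0" by simp
      have "tilt q C e (a *\<^sub>R x) / a \<le> tilt q C e x"
      proof (rule greatest)
        fix s c assume "0 \<le> (s::real)" "c \<in> C"
        then have "tilt q C e (a *\<^sub>R x) \<le> q (a *\<^sub>R x + (a * s) *\<^sub>R c) - (a * s) * e"
          using a by (intro lower) auto
        also have "a *\<^sub>R x + (a * s) *\<^sub>R c = a *\<^sub>R (x + s *\<^sub>R c)"
          by (simp add: scaleR_right_distrib)
        also have "q \<dots> = a * q (x + s *\<^sub>R c)" using a q by (intro sublinear_scale) auto
        finally show "tilt q C e (a *\<^sub>R x) / a \<le> q (x + s *\<^sub>R c) - s * e"
          using a by (simp add: field_simps)
      qed
      then show ?thesis using a by (simp add: field_simps)
    qed
  qed
qed

text \<open>Tilting a minimal sublinear functional towards a single vector changes nothing,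
  which says that the functional is additive.\<close>

lemma minimal_sublinear_linear:
  assumes q: "sublinear q" and min: "\<And>r. sublinear r \<Longrightarrow> (\<And>x. r x \<le> q x) \<Longrightarrow> r = q"
  shows "linear q"
proof -
  have add: "q (x + y) = q x + q y" for x y
  proof (rule antisym[OF sublinear_add[OF q]])
    have "tilt q {y} (q y) = q"
      by (rule min) (auto intro!: sublinear_tilt tilt_le q)
    then show "q x + q y \<le> q (x + y)"
      using tilt_lower[OF q, of "{y}" "q y" 1 y x] by simp
  qed
  have neg: "q (- x) = - q x" for x
    using add[of x "- x"] sublinear_zero[OF q] by simp
  have "q (a *\<^sub>R x) = a * q x" for a x
    using sublinear_scale[OF q, of a x] sublinear_scale[OF q, of "- a" x] neg[of "a *\<^sub>R x"]
    by (cases "a \<ge> 0") auto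
  with add show ?thesis by (intro linearI) auto
qed

section \<open>The Hahn-Banach theorem\<close>

text \<open>Zorn's lemma runs on the reversed order, so it yields a minimal sublinear functional
  below \<open>p\<close>. The pointwise infimum of a nonempty chain is its lower bound.\<close>

theorem hahn_banach_sublinear:
  assumes p: "sublinear p"
  obtains f where "linear f" "\<And>x. f x \<le> p x"
proof -
  define A where "A = {q. sublinear q \<and> q \<le> p}"
  have "\<exists>m\<in>A. \<forall>q\<in>A. m \<ge> q \<longrightarrow> q = m"
  proof (rule predicate_Zorn[where P = "(\<ge>)"])
    show "partial_order_on A (relation_of (\<ge>) A)"
      by (rule partial_order_on_relation_ofI) auto
    fix Q assume Q: "Q \<in> Chains (relation_of (\<ge>) A)"
    then have QA: "Q \<subseteq> A" and chain: "\<And>q r. q \<in> Q \<Longrightarrow> r \<in> Q \<Longrightarrow> q \<le> r \<or> r \<le> q"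
      unfolding Chains_def relation_of_def by auto
    show "\<exists>u\<in>A. \<forall>q\<in>Q. q \<ge> u"
    proof (cases "Q = {}")
      case True
      then show ?thesis using p by (auto simp: A_def)
    next
      case False
      define u where "u = (\<lambda>x. INF q\<in>Q. q x)"
      have Qs: "sublinear q" "q \<le> p" if "q \<in> Q" for q using that QA by (auto simp: A_def)
      \<comment> \<open>This bound does not depend on \<open>q\<close>, so the infimum over the
        chain is finite.\<close>
      have "- p (- x) \<le> q x" if "q \<in> Q" for q x
        using sublinear_ge_uminus[OF Qs(1)[OF that], of x] le_funD[OF Qs(2)[OF that], of "- x"] by simp
      then have lower: "u x \<le> q x" if "q \<in> Q" for q x
        unfolding u_def using that by (intro cINF_lower bdd_belowI2[of _ "- p (- x)"]) auto
      have greatest: "l \<le> u x" if "\<And>q. q \<in> Q \<Longrightarrow> l \<le> q x" for l x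
        unfolding u_def using False that by (intro cINF_greatest) auto
      have "sublinear u"
      proof (rule sublinearI)
        fix x y
        \<comment> \<open>The smaller of \<open>q\<close> and \<open>r\<close> can be used at both
          points; this is where the chain property enters.\<close>
        have two: "u (x + y) \<le> q x + r y" if h: "q \<in> Q" "r \<in> Q" for q r
          using chain[OF h]
        proof
          assume "q \<le> r"
          then show ?thesis
            using lower[OF h(1), of "x + y"] sublinear_add[OF Qs(1)[OF h(1)], of x y] le_funD[of q r y] by simp
        next
          assume "r \<le> q"
          then show ?thesis
            using lower[OF h(2), of "x + y"] sublinear_add[OF Qs(1)[OF h(2)], of x y] le_funD[of r q x] by simp
        qed
        have "u (x + y) - q x \<le> u y" if "q \<in> Q" for q
          by (rule greatest) (use two that in \<open>fastforce simp: algebra_simps\<close>)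
        then have "u (x + y) - u y \<le> u x"
          by (intro greatest) (fastforce simp: algebra_simps)
        then show "u (x + y) \<le> u x + u y" by simp
      next
        fix a :: real and x assume a: "0 \<le> a"
        show "u (a *\<^sub>R x) \<le> a * u x"
        proof (cases "a = 0")
          case True
          obtain q where "q \<in> Q" using False by auto
          then show ?thesis using True lower[of q 0] Qs by (simp add: sublinear_zero)
        next
          case False
          with a have a: "a > 0" by simp
          have "u (a *\<^sub>R x) / a \<le> u x"
          proof (rule greatest)
            fix q assume "q \<in> Q"
            then show "u (a *\<^sub>R x) / a \<le> q x"
              using lower[of q "a *\<^sub>R x"] sublinear_scale[OF Qs(1), of q a x] a by (simp add: field_simps)
          qed
          then show ?thesis using a by (simp add: field_simps)
        qed
      qed
      moreover have "u \<le> p"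
      proof (rule le_funI)
        fix x
        obtain q where "q \<in> Q" using False by auto
        then show "u x \<le> p x" using lower[of q x] le_funD[OF Qs(2), of q x] by simp
      qed
      ultimately show ?thesis using lower by (auto simp: A_def le_fun_def intro!: bexI[of _ u])
    qed
  qed
  then obtain m where m: "sublinear m" "m \<le> p" "\<And>q. sublinear q \<Longrightarrow> q \<le> p \<Longrightarrow> q \<le> m \<Longrightarrow> q = m"
    by (auto simp: A_def)
  have "linear m"
  proof (rule minimal_sublinear_linear[OF m(1)])
    fix r assume "sublinear r" "\<And>x. r x \<le> m x"
    then show "r = m" using m(2) by (intro m(3)) (auto simp: le_fun_def intro: order_trans)
  qed
  then show ?thesis using m(2) by (intro that) (auto simp: le_fun_def)
qed

section \<open>Separation from the origin and norming functionals\<close>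

text \<open>A linear functional below the tilted norm is bounded by the norm, and its value at
  \<open>- c\<close> is at most \<open>- e\<close>. Its norm lies in (0,1], so normalising can only
  raise the positive values on \<open>C\<close>.\<close>

theorem separation_norm_one:
  fixes C :: "'a::real_normed_vector set"
  assumes C: "convex C" "C \<noteq> {}" and e: "e > 0" "\<And>c. c \<in> C \<Longrightarrow> e \<le> norm c"
  obtains f :: "'a \<Rightarrow>\<^sub>L real" where "norm f = 1" "\<And>c. c \<in> C \<Longrightarrow> e \<le> f c"
proof -
  note C' = sublinear_norm C e(2)
  obtain f where f: "linear f" "\<And>x. f x \<le> tilt norm C e x"
    using hahn_banach_sublinear[OF sublinear_tilt[OF C']] by blast
  have le: "f x \<le> norm x" for x
    using f(2)[of x] tilt_le[OF C', of x] by simp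
  have abs: "\<bar>f x\<bar> \<le> norm x" for x
    using le[of x] le[of "- x"] linear_neg[OF f(1), of x] by simp
  have bl: "bounded_linear f"
    by (rule bounded_linear_intro[of _ 1]) (use f(1) abs in \<open>auto simp: linear_add linear_scale\<close>)
  define F where "F = Blinfun f"
  have F: "blinfun_apply F = f" using bl by (simp add: F_def bounded_linear_Blinfun_apply)
  have nF: "norm F \<le> 1" by (rule norm_blinfun_bound) (use abs F in auto)
  have ge: "e \<le> f c" if "c \<in> C" for c
    using f(2)[of "- c"] tilt_uminus_le[OF C' that] linear_neg[OF f(1), of c] by simp
  obtain c where "c \<in> C" using C by auto
  then have "F \<noteq> 0" using ge[of c] e(1) F by auto
  then have pos: "norm F > 0" by simp
  show ?thesis
  proof (rule that[of "F /\<^sub>R norm F"])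
    show "norm (F /\<^sub>R norm F) = 1" using pos by simp
    fix c assume "c \<in> C"
    then have "e * norm F \<le> f c" using ge[of c] nF e(1) by (smt (verit) mult_left_le)
    then show "e \<le> (F /\<^sub>R norm F) c" using pos by (simp add: F scaleR_blinfun.rep_eq field_simps)
  qed
qed

lemma norming_functional:
  fixes x :: "'a::real_normed_vector"
  assumes "x \<noteq> 0"
  obtains f :: "'a \<Rightarrow>\<^sub>L real" where "norm f = 1" "f x = norm x"
proof -
  obtain f :: "'a \<Rightarrow>\<^sub>L real" where f: "norm f = 1" "norm x \<le> f x"
    using separation_norm_one[of "{x}" "norm x"] assms by auto
  then have "f x = norm x" using norm_blinfun[of f x] by auto
  with f(1) show ?thesis by (rule that)
qed

section \<open>Slices of the dual ball and the modulus \<beta>\<close>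

text \<open>This is \<beta>(t) \<ge> d without \<open>Inf\<close> and \<open>Sup\<close>, except
  that the supremum over \<open>x\<close> is required to be witnessed by a point.\<close>

definition uniform_slices :: "'a::real_normed_vector itself \<Rightarrow> real \<Rightarrow> real \<Rightarrow> bool" where
  "uniform_slices TYPE('a) t d \<longleftrightarrow>
     (\<forall>f::'a \<Rightarrow>\<^sub>L real. norm f = 1 \<longrightarrow>
       (\<exists>x. norm x = 1 \<and> (\<forall>g::'a \<Rightarrow>\<^sub>L real. norm g \<le> 1 \<and> t \<le> norm (f - g) \<longrightarrow> blinfun_apply g x \<le> 1 - d)))"

lemma blinfun_apply_le_norm:
  fixes g :: "'a::real_normed_vector \<Rightarrow>\<^sub>L real"
  assumes "norm g \<le> 1"
  shows "\<bar>g x\<bar> \<le> norm x"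
  using norm_blinfun[of g x] assms mult_right_mono[of "norm g" 1 "norm x"] by simp

text \<open>For \<open>t <= 2\<close> the functional \<open>- f\<close> is admissible, so the
  infimum runs over a nonempty set; it is bounded below by 0.\<close>

lemma le_beta_fxt_iff:
  fixes f :: "'a::real_normed_vector \<Rightarrow>\<^sub>L real"
  assumes "norm f = 1" "norm x = 1" "t \<le> 2"
  shows "d \<le> beta_fxt f x t \<longleftrightarrow> (\<forall>g. norm g \<le> 1 \<and> t \<le> norm (f - g) \<longrightarrow> blinfun_apply g x \<le> 1 - d)"
proof -
  let ?S = "{1 - blinfun_apply g x |g. norm g \<le> 1 \<and> norm (f - g) \<ge> t}"
  have "f - (- f) = 2 *\<^sub>R f" by (simp add: scaleR_2)
  then have "norm (f - (- f)) = 2" using assms(1) by simp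
  then have "?S \<noteq> {}" using assms by (auto intro!: exI[of _ "- f"])
  moreover have "bdd_below ?S"
    using blinfun_apply_le_norm[of _ x] assms(2) by (intro bdd_belowI[of _ 0]) fastforce
  ultimately show ?thesis
    unfolding beta_fxt_def by (subst le_cInf_iff) fastforce+
qed

lemma beta_fxt_nonneg:
  fixes f :: "'a::real_normed_vector \<Rightarrow>\<^sub>L real"
  assumes "norm f = 1" "norm x = 1" "t \<le> 2"
  shows "0 \<le> beta_fxt f x t"
  using le_beta_fxt_iff[OF assms, of 0] blinfun_apply_le_norm[of _ x] assms(2) by fastforce

text \<open>Testing with \<open>- f\<close> bounds the infimum by \<open>1 + f x\<close>.\<close>

lemma bdd_above_beta_fxt:
  fixes f :: "'a::real_normed_vector \<Rightarrow>\<^sub>L real"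
  assumes "norm f = 1" "t \<le> 2"
  shows "bdd_above ((\<lambda>x. beta_fxt f x t) ` {x. norm x = 1})"
proof (rule bdd_aboveI2)
  fix x :: 'a assume x: "x \<in> {x. norm x = 1}"
  have "f - (- f) = 2 *\<^sub>R f" by (simp add: scaleR_2)
  then have "norm (f - (- f)) = 2" using assms(1) by simp
  then have "(- f) x \<le> 1 - beta_fxt f x t"
    using le_beta_fxt_iff[OF assms(1) _ assms(2), of x "beta_fxt f x t"] x assms by simp
  then show "beta_fxt f x t \<le> 2"
    using blinfun_apply_le_norm[of f x] x assms by (simp add: uminus_blinfun.rep_eq)
qed

text \<open>A nonzero vector makes the unit spheres of the space and of its dual nonempty, so
  \<open>Sup\<close> and \<open>Inf\<close> range over nonempty sets.\<close>

lemma beta_t_pos_iff: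
  assumes "\<exists>x::'a::real_normed_vector. x \<noteq> 0" "t \<le> 2"
  shows "0 < beta_t TYPE('a) t \<longleftrightarrow> (\<exists>d>0. uniform_slices TYPE('a) t d)"
proof
  obtain z :: 'a where "z \<noteq> 0" using assms by auto
  then have "norm (z /\<^sub>R norm z) = 1" by simp
  then have ne: "{x::'a. norm x = 1} \<noteq> {}" by blast
  have nef: "{f::'a \<Rightarrow>\<^sub>L real. norm f = 1} \<noteq> {}"
    using norming_functional[OF \<open>z \<noteq> 0\<close>] by blast
  have upper: "beta_fxt f x t \<le> beta_ft f t" if "norm f = 1" "norm x = 1" for f and x :: 'a
    unfolding beta_ft_def using that assms by (intro cSUP_upper bdd_above_beta_fxt) auto
  show "\<exists>d>0. uniform_slices TYPE('a) t d" if pos: "0 < beta_t TYPE('a) t"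
  proof (intro exI conjI)
    \<comment> \<open>Halving leaves room for a supremum over \<open>x\<close> that is not
      attained.\<close>
    show "0 < beta_t TYPE('a) t / 2" using pos by simp
    show "uniform_slices TYPE('a) t (beta_t TYPE('a) t / 2)"
      unfolding uniform_slices_def
    proof (intro allI impI)
      fix f :: "'a \<Rightarrow>\<^sub>L real" assume f: "norm f = 1"
      obtain e :: 'a where "norm e = 1" using ne by auto
      have "0 \<le> beta_ft g t" if "norm g = 1" for g :: "'a \<Rightarrow>\<^sub>L real"
        using upper[OF that \<open>norm e = 1\<close>] beta_fxt_nonneg[OF that \<open>norm e = 1\<close> assms(2)] by simp
      then have "beta_t TYPE('a) t \<le> beta_ft f t"
        unfolding beta_t_def using f by (intro cINF_lower bdd_belowI2[of _ 0]) auto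
      then have "beta_t TYPE('a) t / 2 < beta_ft f t" using pos by simp
      then obtain x where x: "norm x = 1" "beta_t TYPE('a) t / 2 < beta_fxt f x t"
        unfolding beta_ft_def using less_cSUP_iff[OF ne bdd_above_beta_fxt[OF f assms(2)]] by auto
      then show "\<exists>x. norm x = 1 \<and> (\<forall>g. norm g \<le> 1 \<and> t \<le> norm (f - g) \<longrightarrow>
          blinfun_apply g x \<le> 1 - beta_t TYPE('a) t / 2)"
        using le_beta_fxt_iff[OF f x(1) assms(2)] less_imp_le by blast
    qed
  qed
  show "0 < beta_t TYPE('a) t" if "\<exists>d>0. uniform_slices TYPE('a) t d"
  proof -
    obtain d where d: "d > 0" "uniform_slices TYPE('a) t d" using \<open>\<exists>d>0. _ d\<close> by blast
    have "d \<le> beta_ft f t" if f: "norm f = 1" for f :: "'a \<Rightarrow>\<^sub>L real"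
    proof -
      obtain x where x: "norm x = 1" "\<forall>g::'a \<Rightarrow>\<^sub>L real. norm g \<le> 1 \<and> t \<le> norm (f - g) \<longrightarrow> blinfun_apply g x \<le> 1 - d"
        using d(2) f unfolding uniform_slices_def by blast
      then have "d \<le> beta_fxt f x t" using le_beta_fxt_iff[OF f x(1) assms(2)] by blast
      then show ?thesis using upper[OF f x(1)] by simp
    qed
    then have "d \<le> beta_t TYPE('a) t"
      unfolding beta_t_def using nef by (intro cINF_greatest) auto
    then show ?thesis using d by simp
  qed
qed

section \<open>From uniform slices to enclosing balls\<close>

lemma le_infdistI:
  assumes "S \<noteq> {}" "\<And>z. z \<in> S \<Longrightarrow> d \<le> dist p z"
  shows "d \<le> infdist p S"
  using assms by (simp add: infdist_notempty cINF_greatest)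

text \<open>The condition on \<open>t * M\<close> lets \<open>g\<close> replace \<open>f\<close> on
  vectors of length at most \<open>M\<close> at a cost of \<open>e / 2\<close>. The condition on
  \<open>l * d\<close> makes the gain \<open>l * d\<close> in the other case pay for both
  \<open>M\<close> and the gap \<open>e / 2\<close>.\<close>

lemma subset_cball_far_from:
  fixes C :: "'a::real_normed_vector set"
  assumes f: "norm f = 1" and x: "norm x = 1"
    and slice: "\<And>g::'a \<Rightarrow>\<^sub>L real. norm g \<le> 1 \<Longrightarrow> t \<le> norm (f - g) \<Longrightarrow> blinfun_apply g x \<le> 1 - d"
    and C: "\<And>c. c \<in> C \<Longrightarrow> norm (c - p) \<le> M" "\<And>c. c \<in> C \<Longrightarrow> e \<le> f (c - p)"
    and e: "0 \<le> M" "t * M \<le> e / 2" and lam: "M + e / 2 \<le> l * d" "0 \<le> l" "e / 2 \<le> l"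
  shows "C \<subseteq> cball (p + l *\<^sub>R x) (l - e / 2)"
proof
  fix c assume c: "c \<in> C"
  define v where "v = l *\<^sub>R x - (c - p)"
  have "norm v \<le> l - e / 2"
  proof (cases "v = 0")
    case False
    then obtain g :: "'a \<Rightarrow>\<^sub>L real" where g: "norm g = 1" "g v = norm v"
      by (rule norming_functional)
    have gv: "norm v = l * g x - g (c - p)"
      using g(2) by (simp add: v_def blinfun.diff_right blinfun.scaleR_right)
    show ?thesis
    proof (cases "t \<le> norm (f - g)")
      case True
      then have "l * g x \<le> l * (1 - d)" using slice[of g] g lam by (intro mult_left_mono) auto
      moreover have "- g (c - p) \<le> M"
        using blinfun_apply_le_norm[of g "c - p"] g C(1)[OF c] by simp
      ultimately show ?thesis using gv lam(1) by (simp add: algebra_simps)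
    next
      case False
      have "l * g x \<le> l * 1"
        using blinfun_apply_le_norm[of g x] g x lam by (intro mult_left_mono) auto
      moreover have "\<bar>(f - g) (c - p)\<bar> \<le> e / 2"
      proof -
        have "\<bar>(f - g) (c - p)\<bar> \<le> norm (f - g) * norm (c - p)"
          using norm_blinfun[of "f - g" "c - p"] by simp
        also have "\<dots> \<le> t * M"
          using False C(1)[OF c] e(1) norm_ge_zero[of "f - g"] norm_ge_zero[of "c - p"]
          by (intro mult_mono) (auto simp del: norm_ge_zero)
        finally show ?thesis using e by simp
      qed
      then have "e / 2 \<le> g (c - p)" using C(2)[OF c] unfolding blinfun.diff_left by linarith
      ultimately show ?thesis using gv by simp
    qed
  qed (use lam in simp)
  moreover have "(p + l *\<^sub>R x) - c = v" by (simp add: v_def)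
  ultimately show "c \<in> cball (p + l *\<^sub>R x) (l - e / 2)" by (simp add: dist_norm)
qed

lemma UMIP_if_uniform_slices:
  assumes slices: "\<And>t. 0 < t \<Longrightarrow> t < 1 \<Longrightarrow> \<exists>d>0. uniform_slices TYPE('a::real_normed_vector) t d"
  shows "UMIP TYPE('a)"
  unfolding UMIP_def
proof (intro allI impI)
  fix e :: real assume e: "e > 0"
  \<comment> \<open>\<open>M\<close> bounds the distance from \<open>p\<close> to any point of
    \<open>C\<close> when one point of \<open>C\<close> is closer than \<open>1 / e + e / 2\<close>,
    since the diameter adds at most \<open>1 / e\<close>.\<close>
  define M where "M = 2 / e + e / 2"
  have M: "M > 0" using e by (simp add: M_def add_pos_pos)
  define t where "t = min (e / (2 * M)) (1 / 2)"
  have t: "0 < t" "t < 1" using e M by (auto simp: t_def)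
  have "t * M \<le> e / (2 * M) * M" using M by (intro mult_right_mono) (auto simp: t_def)
  then have tM: "t * M \<le> e / 2" using M by simp
  obtain d where d: "d > 0" "uniform_slices TYPE('a) t d" using slices[OF t] by blast
  define l where "l = max ((M + e / 2) / d) (e / 2)"
  define K where "K = max l (1 / e)"
  have l: "M + e / 2 \<le> l * d" "e / 2 \<le> l" "0 \<le> l"
    using d e M pos_divide_le_eq[OF d(1), of "M + e / 2" l] by (auto simp: l_def)
  have "K > 0" using e by (simp add: K_def less_max_iff_disj)
  moreover have "\<exists>x0 r0. C \<subseteq> cball x0 r0 \<and> e / 2 \<le> infdist p (cball x0 r0) \<and> r0 \<le> K"
    if h: "closed C \<and> convex C \<and> bounded C \<and> diameter C < 1 / e \<and> e \<le> infdist p C"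
    for C :: "'a set" and p
  proof -
    \<comment> \<open>\<open>infdist\<close> to the empty set is 0, so the positive distance
      excludes it.\<close>
    have ne: "C \<noteq> {}" using h e by (auto simp: infdist_def)
    then obtain c0 where c0: "c0 \<in> C" by auto
    have diam: "dist c0 c \<le> 1 / e" if "c \<in> C" for c
      using diameter_bounded_bound[of C c0 c] h c0 that by simp
    show ?thesis
    \<comment> \<open>The split keeps \<open>K\<close> independent of \<open>p\<close>: the slice
      argument needs \<open>C\<close> to lie within \<open>M\<close> of \<open>p\<close>.\<close>
    proof (cases "dist p c0 \<ge> 1 / e + e / 2")
      case True
      show ?thesis
      proof (intro exI conjI)
        show "C \<subseteq> cball c0 (1 / e)" using diam by auto
        show "e / 2 \<le> infdist p (cball c0 (1 / e))"
        proof (rule le_infdistI)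
          show "cball c0 (1 / e) \<noteq> {}" using e by simp
          fix z assume "z \<in> cball c0 (1 / e)"
          then show "e / 2 \<le> dist p z" using True dist_triangle2[of p c0 z] by simp
        qed
        show "1 / e \<le> K" by (simp add: K_def)
      qed
    next
      case False
      have near: "norm (c - p) \<le> M" if "c \<in> C" for c
        using diam[OF that] False dist_triangle[of c p c0]
        by (simp add: M_def dist_norm[of c p, symmetric] dist_commute)
      obtain f :: "'a \<Rightarrow>\<^sub>L real" where f: "norm f = 1" "\<And>y. y \<in> (\<lambda>c. c - p) ` C \<Longrightarrow> e \<le> f y"
      proof (rule separation_norm_one[of "(\<lambda>c. c - p) ` C" e])
        show "convex ((\<lambda>c. c - p) ` C)" using h by (simp add: convex_translation_subtract_eq)
        fix y assume "y \<in> (\<lambda>c. c - p) ` C"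
        then obtain c where "c \<in> C" "y = c - p" by auto
        then show "e \<le> norm y"
          using h infdist_le[of c C p] by (simp add: dist_norm norm_minus_commute)
      qed (use ne e in auto)
      obtain x where x: "norm x = 1"
          "\<And>g::'a \<Rightarrow>\<^sub>L real. norm g \<le> 1 \<Longrightarrow> t \<le> norm (f - g) \<Longrightarrow> blinfun_apply g x \<le> 1 - d"
        using d(2) f(1) unfolding uniform_slices_def by blast
      show ?thesis
      proof (intro exI conjI)
        show sub: "C \<subseteq> cball (p + l *\<^sub>R x) (l - e / 2)"
          by (rule subset_cball_far_from[where M = M and d = d and f = f and t = t])
            (use f x near M tM l in auto)
        show "e / 2 \<le> infdist p (cball (p + l *\<^sub>R x) (l - e / 2))"
        proof (rule le_infdistI)
          show "cball (p + l *\<^sub>R x) (l - e / 2) \<noteq> {}" using sub ne by blast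
          fix z assume z: "z \<in> cball (p + l *\<^sub>R x) (l - e / 2)"
          have "dist p (p + l *\<^sub>R x) = l" using x l by (simp add: dist_norm)
          then show "e / 2 \<le> dist p z"
            using z dist_triangle2[of p "p + l *\<^sub>R x" z] by simp
        qed
        show "l - e / 2 \<le> K" using e by (simp add: K_def)
      qed
    qed
  qed
  ultimately show "\<exists>K>0. \<forall>(C::'a set) p. closed C \<and> convex C \<and> bounded C \<and> diameter C < 1 / e
      \<and> e \<le> infdist p C \<longrightarrow> (\<exists>x0 r0. C \<subseteq> cball x0 r0 \<and> e / 2 \<le> infdist p (cball x0 r0) \<and> r0 \<le> K)"
    by blast
qed

section \<open>From enclosing balls to uniform slices\<close>

text \<open>The norm of \<open>f\<close> need not be attained; the slack of one half is affordable
  in the estimates below.\<close>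

lemma norm_one_attains_half:
  fixes f :: "'a::real_normed_vector \<Rightarrow>\<^sub>L real"
  assumes "norm f = 1"
  obtains u where "norm u = 1" "1 / 2 \<le> f u"
proof -
  obtain v where v: "\<bar>f v\<bar> > 1 / 2 * norm v"
    using norm_blinfun_bound[of "1 / 2" f] assms by (force simp: not_le[symmetric] simp del: not_le)
  define w where "w = (if f v < 0 then - v else v)"
  have w: "f w > 1 / 2 * norm w" using v by (auto simp: w_def blinfun.minus_right)
  then have "w \<noteq> 0" by auto
  then show ?thesis
    using w by (intro that[of "w /\<^sub>R norm w"]) (auto simp: blinfun.scaleR_right field_simps)
qed

text \<open>A quantitative version of Phelps' parallel hyperplane lemma.\<close>

lemma norm_diff_le_if_nonneg_on_slice:
  fixes f g :: "'a::real_normed_vector \<Rightarrow>\<^sub>L real"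
  assumes f: "norm f = 1" and g: "norm g \<le> 1" and e: "0 < e" "e \<le> 1 / 4"
    and nonneg: "\<And>y. norm y \<le> 1 \<Longrightarrow> e \<le> f y \<Longrightarrow> 0 \<le> g y"
  shows "norm (f - g) \<le> 24 * e + (1 - norm g)"
proof -
  obtain u where u: "norm u = 1" "1 / 2 \<le> f u" using norm_one_attains_half[OF f] by blast
  have gu: "g u \<le> 1" using blinfun_apply_le_norm[OF g, of u] u by simp
  have ker1: "- 4 * e \<le> g y" if "f y = 0" "norm y \<le> 1" for y
  proof -
    \<comment> \<open>Mixing in the weight \<open>2 * e\<close> of \<open>u\<close> raises the value
      of \<open>f\<close> from 0 to at least \<open>e\<close> without leaving the unit ball.\<close>
    let ?z = "(1 - 2 * e) *\<^sub>R y + (2 * e) *\<^sub>R u"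
    have "norm ?z \<le> (1 - 2 * e) * norm y + 2 * e * norm u"
      using e by (intro norm_triangle_le) auto
    also have "\<dots> \<le> (1 - 2 * e) * 1 + 2 * e * 1"
      using e that u by (intro add_mono mult_left_mono) auto
    finally have "norm ?z \<le> 1" by simp
    moreover have "e \<le> f ?z"
      using that u e by (simp add: blinfun.add_right blinfun.scaleR_right)
    ultimately have "0 \<le> (1 - 2 * e) * g y + 2 * e * g u"
      using nonneg[of ?z] by (simp add: blinfun.add_right blinfun.scaleR_right)
    moreover have "2 * e * g u \<le> 2 * e * 1" using e gu by (intro mult_left_mono) auto
    ultimately have *: "- (2 * e) \<le> (1 - 2 * e) * g y" by simp
    show ?thesis
    \<comment> \<open>Dividing by \<open>1 - 2 * e\<close>, which is at least 1/2, at most doubles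
      the bound \<open>2 * e\<close>.\<close>
    proof (rule ccontr)
      assume "\<not> ?thesis"
      then have "(1 - 2 * e) * g y < (1 - 2 * e) * (- 4 * e)"
        using e by (intro mult_strict_left_mono) auto
      also have "\<dots> = - (2 * e) - 2 * e * (1 - 4 * e)" by (simp add: algebra_simps)
      also have "\<dots> \<le> - (2 * e)" using e by simp
      finally show False using * by simp
    qed
  qed
  have ker: "\<bar>g y\<bar> \<le> 4 * e * norm y" if "f y = 0" for y
  proof (cases "y = 0")
    case False
    have "- 4 * e \<le> g (y /\<^sub>R norm y)" "- 4 * e \<le> g ((- y) /\<^sub>R norm y)"
      using that False by (intro ker1; simp add: blinfun.scaleR_right blinfun.minus_right)+
    then show ?thesis using False
      by (simp add: blinfun.scaleR_right blinfun.minus_right field_simps abs_le_iff)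
  qed simp
  \<comment> \<open>With this factor \<open>g\<close> and \<open>c *\<^sub>R f\<close> agree at
    \<open>u\<close>, so their difference is determined by \<open>g\<close> on the kernel of
    \<open>f\<close>.\<close>
  define c where "c = g u / f u"
  have c0: "c \<ge> 0" using nonneg[of u] u e by (simp add: c_def)
  have gc: "norm (g - c *\<^sub>R f) \<le> 12 * e"
  proof (rule norm_blinfun_bound)
    fix y
    \<comment> \<open>This is the projection onto the kernel of \<open>f\<close> along
      \<open>u\<close>; as \<open>f u >= 1 / 2\<close>, its norm is at most three times that of
      \<open>y\<close>.\<close>
    define w where "w = y - (f y / f u) *\<^sub>R u"
    have fw: "f w = 0" using u by (simp add: w_def blinfun.diff_right blinfun.scaleR_right)
    have "\<bar>f y / f u\<bar> \<le> 2 * norm y"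
    proof -
      have "\<bar>f y\<bar> \<le> norm y * 1" using blinfun_apply_le_norm[of f y] f by simp
      also have "\<dots> \<le> norm y * (2 * f u)" using u by (intro mult_left_mono) auto
      finally show ?thesis using u by (simp add: field_simps abs_divide)
    qed
    then have "norm w \<le> 3 * norm y"
      using norm_triangle_ineq4[of y "(f y / f u) *\<^sub>R u"] u by (simp add: w_def)
    then have "4 * e * norm w \<le> 4 * e * (3 * norm y)" using e by (intro mult_left_mono) auto
    moreover have "(g - c *\<^sub>R f) y = g w"
      by (simp add: w_def c_def blinfun.diff_left blinfun.scaleR_left blinfun.diff_right blinfun.scaleR_right)
    ultimately show "norm ((g - c *\<^sub>R f) y) \<le> 12 * e * norm y" using ker[OF fw] by simp
  qed (use e in simp)
  have "norm (c *\<^sub>R f) = c" using c0 f by simp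
  then have "\<bar>norm g - c\<bar> \<le> 12 * e" using norm_triangle_ineq3[of g "c *\<^sub>R f"] gc by simp
  then have "\<bar>1 - c\<bar> \<le> 12 * e + (1 - norm g)" using g by simp
  moreover have "norm (f - c *\<^sub>R f) = \<bar>1 - c\<bar>"
  proof -
    have "f - c *\<^sub>R f = (1 - c) *\<^sub>R f" by (simp add: scaleR_left_diff_distrib)
    then show ?thesis using f by simp
  qed
  moreover have "norm (f - g) \<le> norm (f - c *\<^sub>R f) + norm (g - c *\<^sub>R f)"
    using norm_triangle_ineq4[of "f - c *\<^sub>R f" "g - c *\<^sub>R f"] by simp
  ultimately show ?thesis using gc by simp
qed

text \<open>The point of the ball on the segment from 0 to \<open>x\<close> at distance
  \<open>r\<close> from \<open>x\<close> has norm \<open>norm x - r\<close>.\<close>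

lemma cball_away_from_zero:
  fixes x :: "'a::real_normed_vector"
  assumes "0 \<le> r" "0 < e" "e \<le> infdist 0 (cball x r)"
  shows "r + e \<le> norm x"
proof -
  have far: "e \<le> norm z" if "z \<in> cball x r" for z
    using infdist_le[OF that, of 0] assms by simp
  have "r < norm x"
    using far[of 0] assms by (force simp: not_less[symmetric])
  then have pos: "norm x > 0" using assms(1) by linarith
  define z where "z = (1 - r / norm x) *\<^sub>R x"
  have "x - z = (r / norm x) *\<^sub>R x" by (simp add: z_def scaleR_left_diff_distrib)
  then have "norm (x - z) = r" using pos assms by simp
  then have "e \<le> norm z" by (intro far) (simp add: dist_norm)
  also have "norm z = norm x - r"
  proof -
    have "norm z = \<bar>1 - r / norm x\<bar> * norm x" by (simp add: z_def)
    also have "\<dots> = norm x - r" using pos \<open>r < norm x\<close> by (simp add: field_simps)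
    finally show ?thesis .
  qed
  finally show ?thesis by simp
qed

lemma uniform_slices_if_UMIP:
  assumes umip: "UMIP TYPE('a::real_normed_vector)" and t: "0 < t" "t < 1"
  shows "\<exists>d>0. uniform_slices TYPE('a) t d"
proof -
  \<comment> \<open>The final estimate is \<open>24 * e + d\<close> with \<open>d <= e\<close>, so
    \<open>25 * e < t\<close> is needed; \<open>e <= 1 / 50\<close> also gives
    \<open>2 < 1 / e\<close> for the diameter.\<close>
  define e where "e = t / 50"
  have e: "0 < e" "e \<le> 1 / 50" "25 * e < t" using t by (auto simp: e_def)
  obtain K where K: "K > 0" "\<And>(C::'a set) p. closed C \<and> convex C \<and> bounded C \<and> diameter C < 1 / e
      \<and> infdist p C \<ge> e \<Longrightarrow> \<exists>x0 r0. C \<subseteq> cball x0 r0 \<and> infdist p (cball x0 r0) \<ge> e / 2 \<and> r0 \<le> K"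
    using umip e(1) unfolding UMIP_def by meson
  \<comment> \<open>The centre found below has norm at most \<open>K + 1\<close>, so scaling the
    slice condition by that norm loses at most \<open>e / 4\<close>, half of the gap
    \<open>e / 2\<close> between the ball and 0.\<close>
  define d where "d = e / (4 * (K + 1))"
  have d: "0 < d" "d * (K + 1) = e / 4" using e K(1) by (auto simp: d_def field_simps)
  have "d * 1 \<le> d * (K + 1)" using d(1) K(1) by (intro mult_left_mono) auto
  then have de: "d \<le> e" using d(2) e by simp
  have "uniform_slices TYPE('a) t d"
    unfolding uniform_slices_def
  proof (intro allI impI)
    fix f :: "'a \<Rightarrow>\<^sub>L real" assume f: "norm f = 1"
    define C where "C = cball 0 1 \<inter> {y. e \<le> f y}"
    obtain u where u: "norm u = 1" "1 / 2 \<le> f u" using norm_one_attains_half[OF f] by blast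
    have uC: "u \<in> C" using u e by (simp add: C_def)
    have bC: "bounded C" by (auto simp: C_def intro: bounded_subset[OF bounded_cball])
    have "closed C"
      unfolding C_def by (intro closed_Int closed_cball closed_Collect_le continuous_intros)
    moreover have "convex C"
    proof -
      have "convex (blinfun_apply f -` {e..})"
        by (rule convex_linear_vimage) (auto intro: bounded_linear.linear blinfun.bounded_linear_right)
      moreover have "blinfun_apply f -` {e..} = {y. e \<le> f y}" by auto
      ultimately show ?thesis unfolding C_def by (simp add: convex_Int)
    qed
    moreover have "diameter C < 1 / e"
    proof -
      have "diameter C \<le> 2"
      proof (rule diameter_le)
        fix x y assume "x \<in> C" "y \<in> C"
        then show "norm (x - y) \<le> 2" using norm_triangle_ineq4[of x y] by (auto simp: C_def)
      qed (use uC in auto)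
      also have "2 < 1 / e" using e by (simp add: field_simps)
      finally show ?thesis .
    qed
    moreover have "e \<le> infdist 0 C"
    proof (rule le_infdistI)
      fix y assume "y \<in> C"
      then show "e \<le> dist 0 y"
        using blinfun_apply_le_norm[of f y] f abs_ge_self[of "f y"] by (auto simp: C_def)
    qed (use uC in auto)
    ultimately obtain x0 r where r: "C \<subseteq> cball x0 r" "e / 2 \<le> infdist 0 (cball x0 r)" "r \<le> K"
      using K(2)[of C 0] bC by blast
    have ux: "dist x0 u \<le> r" using r(1) uC by auto
    then have "0 \<le> r" using zero_le_dist[of x0 u] by linarith
    then have x0: "r + e / 2 \<le> norm x0" using cball_away_from_zero[of r "e / 2" x0] r e by simp
    then have pos: "norm x0 > 0" using \<open>0 \<le> r\<close> e(1) by linarith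
    have "norm x0 \<le> K + 1"
      using norm_triangle_ineq2[of x0 u] ux r(3) u by (simp add: dist_norm)
    then have dx0: "d * norm x0 \<le> e / 4" using d mult_left_mono[of "norm x0" "K + 1" d] by linarith
    show "\<exists>x. norm x = 1 \<and> (\<forall>g. norm g \<le> 1 \<and> t \<le> norm (f - g) \<longrightarrow> blinfun_apply g x \<le> 1 - d)"
    proof (intro exI conjI allI impI)
      show x1: "norm (x0 /\<^sub>R norm x0) = 1" using pos by simp
      fix g assume g: "norm g \<le> 1 \<and> t \<le> norm (f - g)"
      show "blinfun_apply g (x0 /\<^sub>R norm x0) \<le> 1 - d"
      proof (rule ccontr)
        assume "\<not> ?thesis"
        then have gx: "1 - d < g (x0 /\<^sub>R norm x0)" by simp
        then have "1 - d < norm g"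
          using norm_blinfun[of g "x0 /\<^sub>R norm x0"] x1 by simp
        have gx0: "norm x0 - d * norm x0 < g x0"
          using gx pos by (simp add: blinfun.scaleR_right field_simps)
        \<comment> \<open>Write \<open>g y\<close> as \<open>g x0 - g (x0 - y)\<close>: the first
          term exceeds \<open>r + e / 4\<close> and the second is at most \<open>r\<close>.\<close>
        have "0 \<le> g y" if "norm y \<le> 1" "e \<le> f y" for y
        proof -
          have "y \<in> C" using that by (simp add: C_def)
          then have "norm (x0 - y) \<le> r" using r(1) by (auto simp: dist_norm)
          then have "g (x0 - y) \<le> r" using blinfun_apply_le_norm[of g "x0 - y"] g by simp
          then show ?thesis using gx0 dx0 x0 e by (simp add: blinfun.diff_right)
        qed
        then have "norm (f - g) \<le> 24 * e + (1 - norm g)"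
          using f g e by (intro norm_diff_le_if_nonneg_on_slice) auto
        then show False using \<open>1 - d < norm g\<close> de e g by simp
      qed
    qed
  qed
  then show ?thesis using d(1) by blast
qed

section \<open>Equivalence of the intersection property with positivity of \<beta>\<close>

theorem mainTheorem13:
  assumes "\<exists>x::'a::banach. x \<noteq> 0"
  shows "UMIP TYPE('a) \<longleftrightarrow> (\<forall>t. 0 < t \<and> t < 1 \<longrightarrow> beta_t TYPE('a) t > 0)"
proof -
  have "(0 < t \<and> t < 1 \<longrightarrow> beta_t TYPE('a) t > 0) \<longleftrightarrow>
      (0 < t \<and> t < 1 \<longrightarrow> (\<exists>d>0. uniform_slices TYPE('a) t d))" for t
    using beta_t_pos_iff[OF assms, of t] by auto
  then show ?thesis
    using UMIP_if_uniform_slices[where 'a = 'a] uniform_slices_if_UMIP[where 'a = 'a] by blast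
qed

end
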